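(* Let $G$ be a connected locally finite graph. For every edge $xy\in E_{\mathrm{tl}}(G)$, $$\mathrm{DN}_{\mathrm{LLY}}(G)\ge\sqrt{(d_x-1)(d_y-1)}.$$ Consequently, if $E_{\mathrm{tl}}(G)\neq\varnothing$, then $$\mathrm{DN}_{\mathrm{LLY}}(G)\ge\sup\left\{\sqrt{(d_x-1)(d_y-1)}: xy\in E_{\mathrm{tl}}(G)\right\}.$$
   Context: Graphs are simple and undirected, possibly infinite; $d_x$ is the combinatorial degree of $x$ in $G$. Let $d(\cdot,\cdot)$ be the combinatorial graph distance. For a positive edge weight $w:E\to(0,\infty)$ put $d_x^w:=\sum_{y\sim x}w_{xy}$. For $\alpha\in[0,1]$ let $\mu_x^{\alpha,w}$ be the probability measure with $\mu_x^{\alpha,w}(x)=\alpha$, $\mu_x^{\alpha,w}(z)=(1-\alpha)w_{xz}/d_x^w$ for $z\sim x$, and $0$ otherwise. Let $W_1$ be the $1$-Wasserstein distance with respect to $d$. For $x\sim y$ let $\kappa_\alpha^w(x,y):=1-W_1(\mu_x^{\alpha,w},\mu_y^{\alpha,w})$ and define the weighted Lin--Lu--Yau curvature $\kappa_{\mathrm{LLY}}^w(x,y):=\lim_{\alpha\to1^-}\kappa_\alpha^w(x,y)/(1-\alpha)$. For connected locally finite $G$ with $E\neq\varnothing$: $\mathrm{Dist}(w):=\sup_{e\in E}w_e/\inf_{e\in E}w_e$, with value $+\infty$ if the supremum is infinite or the infimum is $0$; a positive weight $w$ is admissible if $\kappa_{\mathrm{LLY}}^w(e)\ge0$ for every $e\in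 E$; and $\mathrm{DN}_{\mathrm{LLY}}(G):=\inf\{\mathrm{Dist}(w): w \text{ admissible}\}$, with value $+\infty$ if no admissible weight has finite distortion. $E_{\mathrm{tl}}(G)$ is the set of tree-like edges of $G$, i.e. edges lying on no cycle of $G$ of length $3$, $4$ or $5$. *)

theory Defs
  imports "HOL-Probability.Probability"
begin

section \<open>Simple graphs, possibly infinite\<close>

text \<open>A graph is a vertex set \<open>V\<close> together with a set \<open>E\<close> of edges, each of which is an
  unordered pair \<open>{x, y}\<close> of distinct vertices.\<close>

definition simple_graph :: "'a set \<Rightarrow> 'a set set \<Rightarrow> bool" where
  "simple_graph V E \<longleftrightarrow> (\<forall>e\<in>E. \<exists>x\<in>V. \<exists>y\<in>V. x \<noteq> y \<and> e = {x, y})"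

definition nbrs :: "'a set set \<Rightarrow> 'a \<Rightarrow> 'a set" where
  "nbrs E x = {y. {x, y} \<in> E}"

definition deg :: "'a set set \<Rightarrow> 'a \<Rightarrow> nat" where
  "deg E x = card (nbrs E x)"

definition locally_finite_graph :: "'a set \<Rightarrow> 'a set set \<Rightarrow> bool" where
  "locally_finite_graph V E \<longleftrightarrow> (\<forall>x\<in>V. finite (nbrs E x))"

definition adj_rel :: "'a set set \<Rightarrow> 'a rel" where
  "adj_rel E = {(x, y). {x, y} \<in> E}"

definition connected_graph :: "'a set \<Rightarrow> 'a set set \<Rightarrow> bool" where
  "connected_graph V E \<longleftrightarrow> (\<forall>x\<in>V. \<forall>y\<in>V. (x, y) \<in> (adj_rel E)\<^sup>*)"

text \<open>The combinatorial distance is the least length of a walk; \<open>(x, y) \<in> adj_rel E ^^ n\<close>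
  says that there is a walk of length \<open>n\<close> from \<open>x\<close> to \<open>y\<close>. The value is meaningful only
  for vertices in the same connected component.\<close>

definition gdist :: "'a set set \<Rightarrow> 'a \<Rightarrow> 'a \<Rightarrow> nat" where
  "gdist E x y = (LEAST n. (x, y) \<in> adj_rel E ^^ n)"

text \<open>A cycle of length \<open>n\<close> is given by the list of its \<open>n\<close> distinct vertices, the last one
  being adjacent to the first one.\<close>

definition cycle_edges :: "'a list \<Rightarrow> 'a set set" where
  "cycle_edges c = {{c ! i, c ! (Suc i mod length c)} | i. i < length c}"

definition is_cycle :: "'a set set \<Rightarrow> 'a list \<Rightarrow> bool" where
  "is_cycle E c \<longleftrightarrow> 3 \<le> length c \<and> distinct c \<and> cycle_edges c \<subseteq> E"

definition tree_like_edges :: "'a set set \<Rightarrow> 'a set set" where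
  "tree_like_edges E =
    {e \<in> E. \<not> (\<exists>c. is_cycle E c \<and> length c \<in> {3, 4, 5} \<and> e \<in> cycle_edges c)}"

section \<open>Weighted Lin--Lu--Yau curvature\<close>

definition positive_weight :: "'a set set \<Rightarrow> ('a set \<Rightarrow> real) \<Rightarrow> bool" where
  "positive_weight E w \<longleftrightarrow> (\<forall>e\<in>E. 0 < w e)"

definition wdeg :: "'a set set \<Rightarrow> ('a set \<Rightarrow> real) \<Rightarrow> 'a \<Rightarrow> real" where
  "wdeg E w x = (\<Sum>y\<in>nbrs E x. w {x, y})"

definition mu_fun :: "'a set set \<Rightarrow> ('a set \<Rightarrow> real) \<Rightarrow> real \<Rightarrow> 'a \<Rightarrow> 'a \<Rightarrow> real" where
  "mu_fun E w \<alpha> x z =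
    (if z = x then \<alpha> else if {x, z} \<in> E then (1 - \<alpha>) * w {x, z} / wdeg E w x else 0)"

definition mu :: "'a set set \<Rightarrow> ('a set \<Rightarrow> real) \<Rightarrow> real \<Rightarrow> 'a \<Rightarrow> 'a pmf" where
  "mu E w \<alpha> x = embed_pmf (mu_fun E w \<alpha> x)"

text \<open>\<open>embed_pmf\<close> is specified only for nonnegative functions of total mass 1; this is the case
  for \<open>mu_fun E w \<alpha> x\<close> at every vertex \<open>x\<close> of positive finite degree.\<close>

lemma pmf_mu:
  assumes "simple_graph V E" and "positive_weight E w"
    and "finite (nbrs E x)" and "nbrs E x \<noteq> {}" and "0 \<le> \<alpha>" and "\<alpha> \<le> 1"
  shows "pmf (mu E w \<alpha> x) z = mu_fun E w \<alpha> x z"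
proof -
  have x: "x \<notin> nbrs E x"
    using assms(1) by (fastforce simp: nbrs_def simple_graph_def doubleton_eq_iff)
  have wpos: "0 < w {x, y}" if "y \<in> nbrs E x" for y
    using assms(2) that by (simp add: positive_weight_def nbrs_def)
  have dpos: "0 < wdeg E w x"
    unfolding wdeg_def using assms(3,4) wpos by (intro sum_pos) auto
  have nonneg: "0 \<le> mu_fun E w \<alpha> x z" for z
    using wpos[of z] dpos assms(5,6) by (auto simp: mu_fun_def nbrs_def)
  have supp: "mu_fun E w \<alpha> x z = 0" if "z \<notin> insert x (nbrs E x)" for z
    using that by (auto simp: mu_fun_def nbrs_def)
  have "(\<Sum>z\<in>nbrs E x. mu_fun E w \<alpha> x z) = (\<Sum>z\<in>nbrs E x. (1 - \<alpha>) * w {x, z} / wdeg E w x)"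
    using x by (intro sum.cong) (auto simp: mu_fun_def nbrs_def)
  also have "\<dots> = (1 - \<alpha>) * wdeg E w x / wdeg E w x"
    by (simp add: wdeg_def sum_distrib_left sum_divide_distrib)
  finally have "(\<Sum>z\<in>nbrs E x. mu_fun E w \<alpha> x z) = 1 - \<alpha>"
    using dpos by simp
  then have total: "(\<Sum>z\<in>insert x (nbrs E x). mu_fun E w \<alpha> x z) = 1"
    using x assms(3) by (simp add: mu_fun_def)
  have "(\<integral>\<^sup>+z. ennreal (mu_fun E w \<alpha> x z) \<partial>count_space UNIV)
      = (\<Sum>z\<in>insert x (nbrs E x). ennreal (mu_fun E w \<alpha> x z))"
    using supp assms(3) by (intro nn_integral_count_space') auto
  also have "\<dots> = 1"
    using nonneg total by (subst sum_ennreal) auto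
  finally show ?thesis
    unfolding mu_def using nonneg by (intro pmf_embed_pmf) auto
qed

text \<open>Only finitely supported measures occur below, so the expectation of the distance under
  every coupling is a finite sum and the infimum is over a nonempty set of nonnegative reals.\<close>

definition couplings :: "'a pmf \<Rightarrow> 'a pmf \<Rightarrow> ('a \<times> 'a) pmf set" where
  "couplings p q = {\<pi>. map_pmf fst \<pi> = p \<and> map_pmf snd \<pi> = q}"

definition W1 :: "'a set set \<Rightarrow> 'a pmf \<Rightarrow> 'a pmf \<Rightarrow> real" where
  "W1 E p q =
    (INF \<pi>\<in>couplings p q. measure_pmf.expectation \<pi> (\<lambda>(u, v). real (gdist E u v)))"

definition kappa :: "'a set set \<Rightarrow> ('a set \<Rightarrow> real) \<Rightarrow> real \<Rightarrow> 'a \<Rightarrow> 'a \<Rightarrow> real" where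
  "kappa E w \<alpha> x y = 1 - W1 E (mu E w \<alpha> x) (mu E w \<alpha> y)"

text \<open>For an edge \<open>{x, y}\<close> of a locally finite graph with a positive weight the quotient is
  nondecreasing in \<open>\<alpha>\<close> and bounded above, so the limit exists.\<close>

definition kappa_LLY :: "'a set set \<Rightarrow> ('a set \<Rightarrow> real) \<Rightarrow> 'a \<Rightarrow> 'a \<Rightarrow> real" where
  "kappa_LLY E w x y = Lim (at_left 1) (\<lambda>\<alpha>. kappa E w \<alpha> x y / (1 - \<alpha>))"

section \<open>Distortion number\<close>

definition distortion :: "'a set set \<Rightarrow> ('a set \<Rightarrow> real) \<Rightarrow> ereal" where
  "distortion E w =
    (let s = (SUP e\<in>E. ereal (w e)); i = (INF e\<in>E. ereal (w e))
     in if s = \<infinity> \<or> i = 0 then \<infinity> else s / i)"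

definition admissible :: "'a set set \<Rightarrow> ('a set \<Rightarrow> real) \<Rightarrow> bool" where
  "admissible E w \<longleftrightarrow>
    positive_weight E w \<and> (\<forall>x y. {x, y} \<in> E \<longrightarrow> 0 \<le> kappa_LLY E w x y)"

text \<open>If no admissible weight has finite distortion, the infimum in \<^typ>\<open>ereal\<close> is \<open>\<infinity>\<close>.\<close>

definition DN_LLY :: "'a set set \<Rightarrow> ereal" where
  "DN_LLY E = (INF w\<in>{w. admissible E w}. distortion E w)"

end

theory Submission imports Defs begin

text \<open>Let \<open>xy\<close> be a tree-like edge and \<open>a\<close> its weight. Testing the transport problem against the
  potential with value \<open>0\<close> at \<open>x\<close>, \<open>1\<close> at \<open>y\<close>, \<open>-1\<close> on the other neighbours of \<open>x\<close> and
  \<open>2\<close> on those of \<open>y\<close>, which is 1-Lipschitz between the two supports because \<open>xy\<close> lies on no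
  short cycle, bounds the curvature by \<open>2a/d\<^sub>x + 2a/d\<^sub>y - 2\<close> (weighted degrees). Nonnegative
  curvature therefore means \<open>(d\<^sub>x - a) (d\<^sub>y - a) \<le> a\<^sup>2\<close>, and the two factors on the left are sums
  of as many edge weights as \<open>x\<close> and \<open>y\<close> have other neighbours.\<close>

section \<open>Tree-like edges\<close>

lemma simple_graphD:
  assumes "simple_graph V E" "{x, y} \<in> E"
  shows "x \<noteq> y" "x \<in> V" "y \<in> V"
  using assms by (fastforce simp: simple_graph_def doubleton_eq_iff)+

lemma tree_like_edge_in_edges: "e \<in> tree_like_edges E \<Longrightarrow> e \<in> E"
  by (simp add: tree_like_edges_def)

lemma cycle_edges_eq_image:
  "cycle_edges c = (\<lambda>i. {c ! i, c ! (Suc i mod length c)}) ` {..<length c}"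
  by (auto simp: cycle_edges_def)

lemma tree_like_edge_no_triangle:
  assumes "simple_graph V E" "{x, y} \<in> tree_like_edges E" "{x, z} \<in> E"
  shows "{z, y} \<notin> E"
proof
  assume "{z, y} \<in> E"
  moreover note E = tree_like_edge_in_edges[OF assms(2)]
  ultimately have "is_cycle E [x, y, z]"
    using assms(3) simple_graphD(1)[OF assms(1)]
    by (auto simp: is_cycle_def cycle_edges_eq_image lessThan_Suc insert_commute)
  moreover have "{x, y} \<in> cycle_edges [x, y, z]"
    by (simp add: cycle_edges_eq_image lessThan_Suc)
  moreover have "length [x, y, z] \<in> {3, 4, 5}" by simp
  ultimately show False
    using assms(2) unfolding tree_like_edges_def by blast
qed

lemma tree_like_edge_no_quadrilateral:
  assumes "simple_graph V E" "{x, y} \<in> tree_like_edges E" "{x, z} \<in> E" "z \<noteq> y"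
    "{y, z'} \<in> E" "z' \<noteq> x"
  shows "{z, z'} \<notin> E"
proof
  assume "{z, z'} \<in> E"
  moreover note E = tree_like_edge_in_edges[OF assms(2)]
  ultimately have "is_cycle E [x, y, z', z]"
    using assms(3-) simple_graphD(1)[OF assms(1)]
    by (auto simp: is_cycle_def cycle_edges_eq_image lessThan_Suc insert_commute)
  moreover have "{x, y} \<in> cycle_edges [x, y, z', z]"
    by (simp add: cycle_edges_eq_image lessThan_Suc)
  moreover have "length [x, y, z', z] \<in> {3, 4, 5}" by simp
  ultimately show False
    using assms(2) unfolding tree_like_edges_def by blast
qed

lemma tree_like_edge_no_pentagon:
  assumes "simple_graph V E" "{x, y} \<in> tree_like_edges E" "{x, z} \<in> E" "z \<noteq> y"
    "{y, z'} \<in> E" "z' \<noteq> x" "{z, u} \<in> E"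
  shows "{u, z'} \<notin> E"
proof
  assume u: "{u, z'} \<in> E"
  note E = tree_like_edge_in_edges[OF assms(2)]
  have yx: "{y, x} \<in> tree_like_edges E"
    using assms(2) by (simp add: insert_commute)
  \<comment> \<open>Each of these coincidences would create a triangle through \<open>x\<close> and
    \<open>y\<close>: \<open>z = z'\<close> and \<open>u = y\<close> make \<open>z\<close> a common
    neighbour, and \<open>u = x\<close> makes \<open>z'\<close> one.\<close>
  have "z \<noteq> z'" "u \<noteq> y" "u \<noteq> x"
    using tree_like_edge_no_triangle[OF assms(1,2,3)]
      tree_like_edge_no_triangle[OF assms(1) yx assms(5)] assms u
    by (auto simp: insert_commute)
  then have "is_cycle E [x, y, z', u, z]"
    using assms(3-) E u simple_graphD(1)[OF assms(1)]
    by (auto simp: is_cycle_def cycle_edges_eq_image lessThan_Suc insert_commute)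
  moreover have "{x, y} \<in> cycle_edges [x, y, z', u, z]"
    by (simp add: cycle_edges_eq_image lessThan_Suc)
  moreover have "length [x, y, z', u, z] \<in> {3, 4, 5}" by simp
  ultimately show False
    using assms(2) unfolding tree_like_edges_def by blast
qed

section \<open>Distances between the two neighbourhoods and the test potential\<close>

text \<open>Reachability guarantees that the least length is attained by a walk; for unreachable
  pairs \<open>LEAST\<close> gives an unspecified value.\<close>

lemma gdist_geI:
  assumes "(u, v) \<in> (adj_rel E)\<^sup>*" "\<And>n. n < k \<Longrightarrow> (u, v) \<notin> adj_rel E ^^ n"
  shows "k \<le> gdist E u v"
proof -
  obtain n where "(u, v) \<in> adj_rel E ^^ n"
    using assms(1) rtrancl_imp_relpow by blast
  then have "(u, v) \<in> adj_rel E ^^ gdist E u v"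
    unfolding gdist_def by (rule LeastI)
  then show ?thesis
    using assms(2) not_le by blast
qed

lemma gdist_edge:
  assumes "simple_graph V E" "{x, y} \<in> E"
  shows "gdist E x y = 1"
  unfolding gdist_def
proof (rule Least_equality)
  show "(x, y) \<in> adj_rel E ^^ 1"
    using assms by (simp add: adj_rel_def)
  show "1 \<le> n" if "(x, y) \<in> adj_rel E ^^ n" for n
    using that simple_graphD(1)[OF assms] by (cases n) auto
qed

text \<open>The order of the tests matters, since \<open>y\<close> is itself a neighbour of
  \<open>x\<close>. The default 2 is meant for the other neighbours of \<open>y\<close>; vertices
  away from the edge carry no mass of either measure.\<close>

definition edge_potential :: "'a set set \<Rightarrow> 'a \<Rightarrow> 'a \<Rightarrow> 'a \<Rightarrow> real" where
  "edge_potential E x y z =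
    (if z = x then 0 else if z = y then 1 else if {x, z} \<in> E then - 1 else 2)"

text \<open>The inequality is one-sided and local because transport goes only from the closed
  neighbourhood of \<open>x\<close> to that of \<open>y\<close>. Each gap of the potential is
  matched by ruling out all shorter walks.\<close>

lemma edge_potential_le_gdist:
  assumes "simple_graph V E" "connected_graph V E" "{x, y} \<in> tree_like_edges E"
    and u: "u \<in> insert x (nbrs E x)" and v: "v \<in> insert y (nbrs E y)"
  shows "edge_potential E x y v - edge_potential E x y u \<le> real (gdist E u v)"
proof -
  note G = simple_graphD[OF assms(1)]
  note E = tree_like_edge_in_edges[OF assms(3)]
  note tri = tree_like_edge_no_triangle[OF assms(1,3)]
  note quad = tree_like_edge_no_quadrilateral[OF assms(1,3)]
  note pent = tree_like_edge_no_pentagon[OF assms(1,3)]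
  have "u \<in> V" "v \<in> V"
    using u v E G by (auto simp: nbrs_def)
  then have conn: "(u, v) \<in> (adj_rel E)\<^sup>*"
    using assms(2) by (auto simp: connected_graph_def)
  have ge1: "1 \<le> real (gdist E u v)" if "u \<noteq> v"
    using gdist_geI[OF conn, of 1] that by simp
  have ge2: "2 \<le> real (gdist E u v)" if "u \<noteq> v" "{u, v} \<notin> E"
  proof -
    have "(u, v) \<notin> adj_rel E ^^ n" if "n < 2" for n
    proof -
      consider "n = 0" | "n = 1" using \<open>n < 2\<close> by linarith
      then show ?thesis
        using \<open>u \<noteq> v\<close> \<open>{u, v} \<notin> E\<close> by cases (auto simp: adj_rel_def)
    qed
    then show ?thesis
      using gdist_geI[OF conn, of 2] by simp
  qed
  have ge3: "3 \<le> real (gdist E u v)"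
    if "u \<noteq> v" "{u, v} \<notin> E" "\<And>t. {u, t} \<in> E \<Longrightarrow> {t, v} \<notin> E"
  proof -
    have "(u, v) \<notin> adj_rel E ^^ n" if "n < 3" for n
    proof -
      consider "n = 0" | "n = 1" | "n = Suc 1" using \<open>n < 3\<close> by linarith
      then show ?thesis
        using \<open>u \<noteq> v\<close> \<open>{u, v} \<notin> E\<close> \<open>\<And>t. {u, t} \<in> E \<Longrightarrow> {t, v} \<notin> E\<close>
        by cases (auto simp: adj_rel_def)
    qed
    then show ?thesis
      using gdist_geI[OF conn, of 3] by simp
  qed
  have xy: "x \<noteq> y" using G(1)[OF E] .
  consider "u = x" | "u = y" | "u \<noteq> x" "u \<noteq> y" "{x, u} \<in> E"
    using u by (auto simp: nbrs_def)
  note u_cases = this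
  \<comment> \<open>The absence of triangles gives \<open>{x, v} \<notin> E\<close>, so the
    potential takes its default value 2 in the last case.\<close>
  consider "v = x" | "v = y" | "v \<noteq> x" "v \<noteq> y" "{y, v} \<in> E" "{x, v} \<notin> E"
    using v tri by (auto simp: nbrs_def insert_commute)
  note v_cases = this
  show ?thesis
  proof (cases rule: u_cases)
    case 1
    with xy ge1 ge2 show ?thesis
      by (cases rule: v_cases) (auto simp: edge_potential_def)
  next
    case 2
    with xy ge1 show ?thesis
      by (cases rule: v_cases) (auto simp: edge_potential_def)
  next
    case 3
    then have f: "edge_potential E x y u = - 1"
      by (simp add: edge_potential_def)
    show ?thesis
    proof (cases rule: v_cases)
      case 1
      with f ge1 \<open>u \<noteq> x\<close> show ?thesis by (simp add: edge_potential_def)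
    next
      case 2
      with f ge2 3 tri[of u] xy show ?thesis by (simp add: edge_potential_def)
    next
      \<comment> \<open>The extreme gap, from -1 to 2: lengths 0, 1 and 2 would close a triangle, a
        quadrilateral or a pentagon.\<close>
      case v: 3
      have "u \<noteq> v" using 3 v by auto
      then have "3 \<le> real (gdist E u v)"
        using ge3 quad[of u v] pent[of u v] 3 v by blast
      with f v xy show ?thesis by (simp add: edge_potential_def)
    qed
  qed
qed

section \<open>Transport distance\<close>

lemma coupling_support:
  assumes "\<pi> \<in> couplings p q"
  shows "set_pmf \<pi> \<subseteq> set_pmf p \<times> set_pmf q"
  using assms by (force simp: couplings_def)

lemma W1_le:
  assumes "\<pi> \<in> couplings p q"
  shows "W1 E p q \<le> measure_pmf.expectation \<pi> (\<lambda>(u, v). real (gdist E u v))"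
  unfolding W1_def
  by (rule cINF_lower[OF _ assms], rule bdd_belowI2[where m = 0])
     (auto intro!: integral_nonneg simp: case_prod_beta)

lemma W1_geI:
  assumes "\<And>\<pi>. \<pi> \<in> couplings p q \<Longrightarrow>
    c \<le> measure_pmf.expectation \<pi> (\<lambda>(u, v). real (gdist E u v))"
  shows "c \<le> W1 E p q"
  unfolding W1_def
proof (rule cINF_greatest[OF _ assms])
  \<comment> \<open>The independent coupling always exists, so the real infimum is over a nonempty
    set.\<close>
  have "pair_pmf p q \<in> couplings p q"
    by (simp add: couplings_def map_fst_pair_pmf map_snd_pair_pmf)
  then show "couplings p q \<noteq> {}" by blast
qed

text \<open>The easy half of Kantorovich duality: integrate the Lipschitz bound against any coupling
  and use its marginals. Finite supports settle integrability.\<close>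

lemma W1_ge_potential:
  assumes fin: "finite (set_pmf p)" "finite (set_pmf q)"
    and lip: "\<And>u v. u \<in> set_pmf p \<Longrightarrow> v \<in> set_pmf q \<Longrightarrow> f v - f u \<le> real (gdist E u v)"
  shows "measure_pmf.expectation q f - measure_pmf.expectation p f \<le> W1 E p q"
proof (rule W1_geI)
  fix \<pi> assume \<pi>: "\<pi> \<in> couplings p q"
  then have supp: "set_pmf \<pi> \<subseteq> set_pmf p \<times> set_pmf q" by (rule coupling_support)
  then have "finite (set_pmf \<pi>)" using fin finite_subset by blast
  then have int: "integrable (measure_pmf \<pi>) h" for h :: "_ \<Rightarrow> real"
    by (rule integrable_measure_pmf_finite)
  have "measure_pmf.expectation q f - measure_pmf.expectation p f
      = measure_pmf.expectation \<pi> (\<lambda>t. f (snd t) - f (fst t))"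
    using \<pi> int by (auto simp: couplings_def)
  also have "\<dots> \<le> measure_pmf.expectation \<pi> (\<lambda>(u, v). real (gdist E u v))"
    using supp lip by (intro integral_mono_AE int) (auto simp: AE_measure_pmf_iff)
  finally show "measure_pmf.expectation q f - measure_pmf.expectation p f
      \<le> measure_pmf.expectation \<pi> (\<lambda>(u, v). real (gdist E u v))" .
qed

text \<open>Convexity of transport cost: any plan from \<open>p\<close> to \<open>q\<close> can be
  mixed with the plan moving \<open>x\<close> to \<open>y\<close>.\<close>

lemma W1_mix_le:
  assumes fin: "finite (set_pmf p)" "finite (set_pmf q)" and t: "0 \<le> t" "t < 1"
    and p': "\<And>z. pmf p' z = (1 - t) * pmf p z + t * indicator {x} z"
    and q': "\<And>z. pmf q' z = (1 - t) * pmf q z + t * indicator {y} z"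
  shows "W1 E p' q' \<le> (1 - t) * W1 E p q + t * real (gdist E x y)"
proof -
  \<comment> \<open>Solved for \<open>W1 E p q\<close>, the claim is a lower bound on an infimum and
    can be checked coupling by coupling, without an optimal one.\<close>
  have "(W1 E p' q' - t * real (gdist E x y)) / (1 - t) \<le> W1 E p q"
  proof (rule W1_geI)
    fix \<pi> assume \<pi>: "\<pi> \<in> couplings p q"
    then have "finite (set_pmf \<pi>)"
      using fin by (intro finite_subset[OF coupling_support]) auto
    define \<rho> where
      "\<rho> = bind_pmf (bernoulli_pmf t) (\<lambda>b. if b then return_pmf (x, y) else \<pi>)"
    \<comment> \<open>Stated for arbitrary \<open>g\<close> so as to give both marginals.\<close>
    have map_\<rho>: "pmf (map_pmf g \<rho>) z
        = (1 - t) * pmf (map_pmf g \<pi>) z + t * indicator {g (x, y)} z" for g :: "_ \<Rightarrow> 'a" and z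
    proof -
      have "map_pmf g \<rho> = bind_pmf (bernoulli_pmf t)
          (\<lambda>b. if b then return_pmf (g (x, y)) else map_pmf g \<pi>)"
        unfolding \<rho>_def map_bind_pmf by (intro bind_pmf_cong) auto
      then show ?thesis
        using t by (simp add: pmf_bind indicator_def mult.commute)
    qed
    have "map_pmf fst \<rho> = p'" "map_pmf snd \<rho> = q'"
      using \<pi> map_\<rho> by (auto simp: p' q' couplings_def intro!: pmf_eqI)
    then have "W1 E p' q' \<le> measure_pmf.expectation \<rho> (\<lambda>(u, v). real (gdist E u v))"
      by (intro W1_le) (simp add: couplings_def)
    also have "\<dots> = (1 - t) * measure_pmf.expectation \<pi> (\<lambda>(u, v). real (gdist E u v))
        + t * real (gdist E x y)"
      unfolding \<rho>_def using t \<open>finite (set_pmf \<pi>)\<close>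
      by (subst pmf_expectation_bind[where A = UNIV]) (auto simp: UNIV_bool)
    finally show "(W1 E p' q' - t * real (gdist E x y)) / (1 - t)
        \<le> measure_pmf.expectation \<pi> (\<lambda>(u, v). real (gdist E u v))"
      using t by (simp add: pos_divide_le_eq mult.commute)
  qed
  then show ?thesis using t by (simp add: pos_divide_le_eq mult.commute)
qed

section \<open>Weighted curvature and distortion\<close>

locale weighted_graph =
  fixes V :: "'a set" and E :: "'a set set" and w :: "'a set \<Rightarrow> real"
  assumes simple: "simple_graph V E"
    and loc_fin: "locally_finite_graph V E"
    and pos: "positive_weight E w"
begin

section \<open>Lazy random walk measures and the limit curvature\<close>

lemma weight_pos: "{x, y} \<in> E \<Longrightarrow> 0 < w {x, y}"
  using pos by (simp add: positive_weight_def)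

lemma finite_nbrs: "{x, y} \<in> E \<Longrightarrow> finite (nbrs E x)"
  using simple_graphD[OF simple] loc_fin by (auto simp: locally_finite_graph_def)

lemma pmf_mu_edge:
  assumes "{x, y} \<in> E" "0 \<le> \<alpha>" "\<alpha> \<le> 1"
  shows "pmf (mu E w \<alpha> x) z = mu_fun E w \<alpha> x z"
  using assms finite_nbrs[OF assms(1)] by (intro pmf_mu[OF simple pos]) (auto simp: nbrs_def)

lemma set_pmf_mu:
  assumes "{x, y} \<in> E" "0 \<le> \<alpha>" "\<alpha> \<le> 1"
  shows "set_pmf (mu E w \<alpha> x) \<subseteq> insert x (nbrs E x)"
  using pmf_mu_edge[OF assms] by (auto simp: set_pmf_iff mu_fun_def nbrs_def split: if_splits)

lemma finite_set_pmf_mu: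
  assumes "{x, y} \<in> E" "0 \<le> \<alpha>" "\<alpha> \<le> 1"
  shows "finite (set_pmf (mu E w \<alpha> x))"
  using finite_subset[OF set_pmf_mu[OF assms]] finite_nbrs[OF assms(1)] by simp

lemma expectation_mu:
  assumes "{x, y} \<in> E" "0 \<le> \<alpha>" "\<alpha> \<le> 1"
  shows "measure_pmf.expectation (mu E w \<alpha> x) f
    = \<alpha> * f x + (1 - \<alpha>) * (\<Sum>z\<in>nbrs E x. w {x, z} * f z) / wdeg E w x"
proof -
  have x: "x \<notin> nbrs E x"
    using simple_graphD(1)[OF simple, of x x] by (auto simp: nbrs_def)
  have "measure_pmf.expectation (mu E w \<alpha> x) f
      = (\<Sum>z\<in>insert x (nbrs E x). f z * mu_fun E w \<alpha> x z)"
    using set_pmf_mu[OF assms] finite_nbrs[OF assms(1)]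
    by (subst integral_measure_pmf_real) (auto simp: pmf_mu_edge[OF assms])
  also have "\<dots> = \<alpha> * f x + (\<Sum>z\<in>nbrs E x. f z * mu_fun E w \<alpha> x z)"
    using x finite_nbrs[OF assms(1)] by (simp add: mu_fun_def)
  also have "(\<Sum>z\<in>nbrs E x. f z * mu_fun E w \<alpha> x z)
      = (\<Sum>z\<in>nbrs E x. (1 - \<alpha>) * (w {x, z} * f z) / wdeg E w x)"
    using x by (intro sum.cong) (auto simp: mu_fun_def nbrs_def)
  finally show ?thesis
    by (simp add: sum_distrib_left sum_divide_distrib)
qed

text \<open>The measures for \<open>\<beta>\<close> are mixtures of those for \<open>\<alpha>\<close> with point masses at \<open>x\<close> and \<open>y\<close>.
  Monotonicity makes the limit defining \<^const>\<open>kappa_LLY\<close> exist, without which \<^const>\<open>Lim\<close> would be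
  an arbitrary value.\<close>

lemma kappa_quotient_mono:
  assumes e: "{x, y} \<in> E" and ab: "0 \<le> \<alpha>" "\<alpha> \<le> \<beta>" "\<beta> < 1"
  shows "kappa E w \<alpha> x y / (1 - \<alpha>) \<le> kappa E w \<beta> x y / (1 - \<beta>)"
proof -
  \<comment> \<open>Chosen so that \<open>1 - t\<close> rescales the moving mass
    \<open>1 - \<alpha>\<close> to \<open>1 - \<beta>\<close>.\<close>
  define t where "t = (\<beta> - \<alpha>) / (1 - \<alpha>)"
  have t: "0 \<le> t" "t < 1" "1 - t = (1 - \<beta>) / (1 - \<alpha>)" "t = 1 - (1 - \<beta>) / (1 - \<alpha>)"
    using ab by (auto simp: t_def field_simps)
  have e': "{y, x} \<in> E" using e by (simp add: insert_commute)
  have mix: "pmf (mu E w \<beta> a) z = (1 - t) * pmf (mu E w \<alpha> a) z + t * indicator {a} z"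
    if "{a, b} \<in> E" for a b z
  proof -
    have "mu_fun E w \<beta> a z = (1 - t) * mu_fun E w \<alpha> a z + t * indicator {a} z"
    proof (cases "z = a")
      case True
      have "t * (1 - \<alpha>) = \<beta> - \<alpha>" using ab by (simp add: t_def)
      then show ?thesis using True by (simp add: mu_fun_def algebra_simps)
    next
      case False
      then show ?thesis using ab unfolding t(3) by (simp add: mu_fun_def)
    qed
    then show ?thesis
      using ab pmf_mu_edge[OF that, of \<alpha>] pmf_mu_edge[OF that, of \<beta>] by simp
  qed
  have "W1 E (mu E w \<beta> x) (mu E w \<beta> y)
      \<le> (1 - t) * W1 E (mu E w \<alpha> x) (mu E w \<alpha> y) + t * real (gdist E x y)"
    using ab t by (intro W1_mix_le mix[OF e] mix[OF e'] finite_set_pmf_mu[OF e]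
        finite_set_pmf_mu[OF e']) auto
  \<comment> \<open>Since \<open>x\<close> and \<open>y\<close> are at distance 1, the added cost is
    exactly \<open>t\<close>, and \<open>1 - ((1 - t) * W + t) = (1 - t) * (1 - W)\<close>.\<close>
  then have "(1 - t) * kappa E w \<alpha> x y \<le> kappa E w \<beta> x y"
    using gdist_edge[OF simple e] by (simp add: kappa_def algebra_simps)
  then have "(1 - t) * kappa E w \<alpha> x y / (1 - \<beta>) \<le> kappa E w \<beta> x y / (1 - \<beta>)"
    using ab by (intro divide_right_mono) auto
  also have "(1 - t) * kappa E w \<alpha> x y / (1 - \<beta>) = kappa E w \<alpha> x y / (1 - \<alpha>)"
    using ab unfolding t(3) by simp
  finally show ?thesis .
qed

text \<open>A nondecreasing quotient bounded by \<open>K\<close> converges from the left to its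
  supremum over \<open>{0..<1}\<close>, which inherits the bound.\<close>

lemma kappa_LLY_le:
  assumes e: "{x, y} \<in> E"
    and bound: "\<And>\<alpha>. 0 \<le> \<alpha> \<Longrightarrow> \<alpha> < 1 \<Longrightarrow> kappa E w \<alpha> x y / (1 - \<alpha>) \<le> K"
  shows "kappa_LLY E w x y \<le> K"
proof -
  let ?f = "\<lambda>\<alpha>. kappa E w \<alpha> x y / (1 - \<alpha>)"
  define L where "L = (SUP \<alpha>\<in>{0..<1}. ?f \<alpha>)"
  have bdd: "bdd_above (?f ` {0..<1})"
    using bound by (intro bdd_aboveI2[where M = K]) auto
  have ev: "\<forall>\<^sub>F \<alpha> in at_left (1::real). b < \<alpha> \<and> \<alpha> < 1" if "b < 1" for b
    using eventually_at_left_real[OF that] by eventually_elim auto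
  have "(?f \<longlongrightarrow> L) (at_left 1)"
  proof (rule increasing_tendsto)
    show "\<forall>\<^sub>F \<alpha> in at_left 1. ?f \<alpha> \<le> L"
      using ev[of 0] unfolding L_def
      by (auto elim!: eventually_mono intro!: cSUP_upper[OF _ bdd])
    fix l assume "l < L"
    then obtain b where b: "b \<in> {0..<1}" "l < ?f b"
      unfolding L_def using less_cSUP_iff[OF _ bdd] by auto
    have "l < ?f \<alpha>" if "b < \<alpha> \<and> \<alpha> < 1" for \<alpha>
      using kappa_quotient_mono[OF e, of b \<alpha>] b that by auto
    then show "\<forall>\<^sub>F \<alpha> in at_left 1. l < ?f \<alpha>"
      using ev[of b] b by (auto elim!: eventually_mono)
  qed
  then have "kappa_LLY E w x y = L"
    unfolding kappa_LLY_def by (intro tendsto_Lim) auto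
  also have "L \<le> K"
    unfolding L_def using bound by (intro cSUP_least) auto
  finally show ?thesis .
qed

section \<open>Weighted degrees and neighbour sums\<close>

lemma wdeg_eq:
  assumes "{x, y} \<in> E"
  shows "wdeg E w x = w {x, y} + (\<Sum>z\<in>nbrs E x - {y}. w {x, z})"
  unfolding wdeg_def using assms finite_nbrs[OF assms]
  by (subst sum.remove[where x = y]) (auto simp: nbrs_def)

lemma wdeg_pos:
  assumes "{x, y} \<in> E"
  shows "0 < wdeg E w x"
  unfolding wdeg_def using assms finite_nbrs[OF assms] weight_pos
  by (intro sum_pos) (auto simp: nbrs_def)

text \<open>Removing \<open>y\<close> leaves \<open>deg E x - 1\<close> neighbours, each
  contributing at least \<open>m\<close>; later \<open>m\<close> is the infimum of the
  weights.\<close>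

lemma wdeg_ge_deg:
  assumes "{x, y} \<in> E" and "\<And>e. e \<in> E \<Longrightarrow> m \<le> w e"
  shows "(real (deg E x) - 1) * m \<le> wdeg E w x - w {x, y}"
proof -
  have y: "y \<in> nbrs E x" using assms by (simp add: nbrs_def)
  then have "Suc (card (nbrs E x - {y})) = deg E x"
    unfolding deg_def using finite_nbrs[OF assms(1)] by (intro card.remove[symmetric])
  then have "real (deg E x) - 1 = real (card (nbrs E x - {y}))"
    by linarith
  moreover have "real (card (nbrs E x - {y})) * m \<le> (\<Sum>z\<in>nbrs E x - {y}. w {x, z})"
    using assms(2) by (intro sum_bounded_below) (auto simp: nbrs_def)
  ultimately show ?thesis using wdeg_eq[OF assms(1)] by simp
qed

lemma weighted_nbr_sum:
  assumes "{x, y} \<in> E" and "\<And>z. z \<in> nbrs E x - {y} \<Longrightarrow> f z = c"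
  shows "(\<Sum>z\<in>nbrs E x. w {x, z} * f z) = w {x, y} * f y + c * (wdeg E w x - w {x, y})"
proof -
  have "(\<Sum>z\<in>nbrs E x. w {x, z} * f z) = w {x, y} * f y + (\<Sum>z\<in>nbrs E x - {y}. w {x, z} * f z)"
    using assms finite_nbrs[OF assms(1)] by (subst sum.remove[where x = y]) (auto simp: nbrs_def)
  also have "(\<Sum>z\<in>nbrs E x - {y}. w {x, z} * f z) = (\<Sum>z\<in>nbrs E x - {y}. c * w {x, z})"
    using assms(2) by (intro sum.cong) auto
  finally show ?thesis using wdeg_eq[OF assms(1)] by (simp add: sum_distrib_left)
qed

section \<open>Curvature and weights at a tree-like edge\<close>

lemma kappa_LLY_tree_like_le:
  assumes conn: "connected_graph V E" and tl: "{x, y} \<in> tree_like_edges E"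
  shows "kappa_LLY E w x y \<le> 2 * w {x, y} / wdeg E w x + 2 * w {x, y} / wdeg E w y - 2"
proof (rule kappa_LLY_le)
  let ?f = "edge_potential E x y"
  show e: "{x, y} \<in> E" using tl by (rule tree_like_edge_in_edges)
  then have e': "{y, x} \<in> E" by (simp add: insert_commute)
  have xy: "x \<noteq> y" using simple_graphD(1)[OF simple e] .
  then have f: "?f x = 0" "?f y = 1" by (simp_all add: edge_potential_def)
  fix \<alpha> :: real assume \<alpha>: "0 \<le> \<alpha>" "\<alpha> < 1"
  have "measure_pmf.expectation (mu E w \<alpha> y) ?f - measure_pmf.expectation (mu E w \<alpha> x) ?f
      \<le> W1 E (mu E w \<alpha> x) (mu E w \<alpha> y)"
    using \<alpha> set_pmf_mu[OF e, of \<alpha>] set_pmf_mu[OF e', of \<alpha>]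
    by (intro W1_ge_potential finite_set_pmf_mu[OF e] finite_set_pmf_mu[OF e']
        edge_potential_le_gdist[OF simple conn tl]) auto
  moreover have "measure_pmf.expectation (mu E w \<alpha> x) ?f
      = (1 - \<alpha>) * (2 * w {x, y} / wdeg E w x - 1)"
  proof -
    \<comment> \<open>With value 1 at \<open>y\<close> and -1 elsewhere, the neighbour sum is the
      edge weight minus the remaining weight at \<open>x\<close>.\<close>
    have "?f z = - 1" if "z \<in> nbrs E x - {y}" for z
      using that simple_graphD(1)[OF simple, of x z] by (auto simp: edge_potential_def nbrs_def)
    from weighted_nbr_sum[OF e this]
    have "(\<Sum>z\<in>nbrs E x. w {x, z} * ?f z) = 2 * w {x, y} - wdeg E w x"
      using f by simp
    then have "measure_pmf.expectation (mu E w \<alpha> x) ?f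
        = (1 - \<alpha>) * (2 * w {x, y} - wdeg E w x) / wdeg E w x"
      using expectation_mu[OF e, of \<alpha> ?f] \<alpha> f by simp
    also have "\<dots> = (1 - \<alpha>) * (2 * w {x, y} / wdeg E w x - 1)"
      using wdeg_pos[OF e] by (simp add: diff_divide_distrib right_diff_distrib)
    finally show ?thesis .
  qed
  moreover have "measure_pmf.expectation (mu E w \<alpha> y) ?f
      = \<alpha> + (1 - \<alpha>) * (2 - 2 * w {x, y} / wdeg E w y)"
  proof -
    have "?f z = 2" if "z \<in> nbrs E y - {x}" for z
    proof -
      have z: "{y, z} \<in> E" "z \<noteq> x" using that by (auto simp: nbrs_def)
      then have "z \<noteq> y" using simple_graphD(1)[OF simple, of y z] by blast
      moreover have "{x, z} \<notin> E"
        using tree_like_edge_no_triangle[OF simple tl, of z] z by (metis insert_commute)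
      ultimately show ?thesis using z by (simp add: edge_potential_def)
    qed
    from weighted_nbr_sum[OF e' this]
    have "(\<Sum>z\<in>nbrs E y. w {y, z} * ?f z) = 2 * (wdeg E w y - w {x, y})"
      using f by (simp add: insert_commute)
    then have "measure_pmf.expectation (mu E w \<alpha> y) ?f
        = \<alpha> + (1 - \<alpha>) * (2 * (wdeg E w y - w {x, y})) / wdeg E w y"
      using expectation_mu[OF e', of \<alpha> ?f] \<alpha> f by simp
    also have "\<dots> = \<alpha> + (1 - \<alpha>) * (2 - 2 * w {x, y} / wdeg E w y)"
      using wdeg_pos[OF e'] by (simp add: diff_divide_distrib right_diff_distrib)
    finally show ?thesis .
  qed
  \<comment> \<open>The term \<open>\<alpha>\<close> from the value 1 at \<open>y\<close> turns the
    leading 1 of \<open>kappa\<close> into \<open>1 - \<alpha>\<close>, which factors out; the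
    quotient bound is thus the same for every \<open>\<alpha>\<close>.\<close>
  ultimately have "kappa E w \<alpha> x y
      \<le> (1 - \<alpha>) * (2 * w {x, y} / wdeg E w x + 2 * w {x, y} / wdeg E w y - 2)"
    by (simp add: kappa_def algebra_simps)
  then show "kappa E w \<alpha> x y / (1 - \<alpha>)
      \<le> 2 * w {x, y} / wdeg E w x + 2 * w {x, y} / wdeg E w y - 2"
    using \<alpha> by (simp add: pos_divide_le_eq mult.commute)
qed

lemma tree_like_weight_bound:
  assumes "connected_graph V E" and tl: "{x, y} \<in> tree_like_edges E"
    and "0 \<le> kappa_LLY E w x y"
  shows "(wdeg E w x - w {x, y}) * (wdeg E w y - w {x, y}) \<le> (w {x, y})\<^sup>2"
proof -
  have e: "{x, y} \<in> E" using tl by (rule tree_like_edge_in_edges)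
  then have e': "{y, x} \<in> E" by (simp add: insert_commute)
  have "1 \<le> w {x, y} / wdeg E w x + w {x, y} / wdeg E w y"
    using kappa_LLY_tree_like_le[OF assms(1,2)] assms(3) by simp
  \<comment> \<open>Multiply by both weighted degrees, then add the square of the edge weight to
    complete the product.\<close>
  then show ?thesis
    using wdeg_pos[OF e] wdeg_pos[OF e'] by (simp add: field_simps power2_eq_square)
qed

section \<open>From weights to the distortion number\<close>

lemma distortion_ge:
  assumes "connected_graph V E" and tl: "{x, y} \<in> tree_like_edges E"
    and "0 \<le> kappa_LLY E w x y"
  shows "ereal (sqrt ((real (deg E x) - 1) * (real (deg E y) - 1))) \<le> distortion E w"
proof -
  have e: "{x, y} \<in> E" using tl by (rule tree_like_edge_in_edges)
  then have e': "{y, x} \<in> E" by (simp add: insert_commute)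
  define s i where "s = (SUP e\<in>E. ereal (w e))" and "i = (INF e\<in>E. ereal (w e))"
  have s: "ereal (w {x, y}) \<le> s" unfolding s_def using e by (rule SUP_upper)
  have i: "i \<le> ereal (w e)" if "e \<in> E" for e unfolding i_def using that by (rule INF_lower)
  have i0: "0 \<le> i"
    unfolding i_def using pos by (intro INF_greatest) (auto simp: positive_weight_def less_imp_le)
  show ?thesis
  \<comment> \<open>In the first case the distortion is infinite by convention; otherwise
    \<open>s\<close> and \<open>i\<close> are positive reals \<open>M\<close> and
    \<open>m\<close>.\<close>
  proof (cases "s = \<infinity> \<or> i = 0")
    case True
    then show ?thesis unfolding distortion_def Let_def s_def i_def by simp
  next
    case False
    obtain m where m: "i = ereal m" "0 < m"
      using False i0 i[OF e] by (cases i) auto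
    obtain M where M: "s = ereal M" "w {x, y} \<le> M"
      using False s by (cases s) auto
    have mw: "m \<le> w e" if "e \<in> E" for e using i[OF that] m by simp
    \<comment> \<open>Keeps the factors \<open>deg - 1\<close> nonnegative, so that the two lower
      bounds may be multiplied.\<close>
    have deg1: "1 \<le> real (deg E a)" if "{a, b} \<in> E" for a b
      using that finite_nbrs[OF that] by (auto simp: deg_def nbrs_def card_gt_0_iff Suc_le_eq)
    define P where "P = (real (deg E x) - 1) * (real (deg E y) - 1)"
    have "P * m\<^sup>2 = ((real (deg E x) - 1) * m) * ((real (deg E y) - 1) * m)"
      by (simp add: P_def power2_eq_square)
    also have "\<dots> \<le> (wdeg E w x - w {x, y}) * (wdeg E w y - w {x, y})"
      using wdeg_ge_deg[OF e mw] wdeg_ge_deg[OF e' mw] deg1[OF e] deg1[OF e'] m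
      by (intro mult_mono') (auto simp: insert_commute)
    also have "\<dots> \<le> (w {x, y})\<^sup>2"
      using tree_like_weight_bound[OF assms] .
    also have "\<dots> \<le> M\<^sup>2"
      using M weight_pos[OF e] by (intro power_mono) auto
    finally have "P \<le> (M / m)\<^sup>2"
      using m by (simp add: power_divide pos_le_divide_eq)
    then have "sqrt P \<le> M / m"
      using M m weight_pos[OF e] by (intro real_le_lsqrt) auto
    then show ?thesis
      using False M m unfolding distortion_def Let_def P_def s_def[symmetric] i_def[symmetric]
      by simp
  qed
qed

end

theorem corollary6p2:
  fixes V :: "'a set" and E :: "'a set set"
  assumes "simple_graph V E"
    and "connected_graph V E"
    and "locally_finite_graph V E"
  shows "(\<forall>x y. {x, y} \<in> tree_like_edges E \<longrightarrow>
            DN_LLY E \<ge> ereal (sqrt ((real (deg E x) - 1) * (real (deg E y) - 1)))) \<and>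
         (tree_like_edges E \<noteq> {} \<longrightarrow>
            DN_LLY E \<ge> Sup {ereal (sqrt ((real (deg E x) - 1) * (real (deg E y) - 1))) |
                              x y. {x, y} \<in> tree_like_edges E})"
proof -
  have *: "ereal (sqrt ((real (deg E x) - 1) * (real (deg E y) - 1))) \<le> DN_LLY E"
    if tl: "{x, y} \<in> tree_like_edges E" for x y
    unfolding DN_LLY_def
  proof (rule INF_greatest)
    \<comment> \<open>Admissibility enters through the curvature of the single edge
      \<open>xy\<close>, while the distortion compares its weight with those of all edges.\<close>
    fix w assume "w \<in> {w. admissible E w}"
    then have w: "positive_weight E w" "0 \<le> kappa_LLY E w x y"
      using tree_like_edge_in_edges[OF tl] by (auto simp: admissible_def)
    interpret weighted_graph V E w
      using assms w by unfold_locales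
    show "ereal (sqrt ((real (deg E x) - 1) * (real (deg E y) - 1))) \<le> distortion E w"
      using assms(2) tl w(2) by (rule distortion_ge)
  qed
  moreover have "Sup {ereal (sqrt ((real (deg E x) - 1) * (real (deg E y) - 1))) |
      x y. {x, y} \<in> tree_like_edges E} \<le> DN_LLY E"
    by (rule Sup_least) (use * in blast)
  ultimately show ?thesis by blast
qed

end
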